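(* Every sequent $\Gamma\vdash\Delta$ that is derivable in the labelled sequent calculus $LS_{BBI}$ is valid with respect to the (non-deterministic monoidal) Kripke semantics of BBI.
   Context: BBI formulae: $A ::= p \mid \top \mid \bot \mid \neg A \mid A\lor A \mid A\land A \mid A\to A \mid \top^* \mid A * A \mid A \mathrel{-\!*} A$, $p$ atomic; in the calculus $\neg A$ abbreviates $A\to\bot$ and $A\lor B$ abbreviates $\neg(\neg A\land\neg B)$. Semantics. A frame is $(\mathcal{M},\triangleright,\epsilon)$ with $\mathcal{M}$ nonempty, $\epsilon\in\mathcal{M}$, $\triangleright\subseteq\mathcal{M}^3$ (written $a,b\triangleright c$) such that for all $a,b,c,d$: $\epsilon,a\triangleright b$ iff $a=b$; $a,b\triangleright c$ iff $b,a\triangleright c$; if $a,k\triangleright d$ and $b,c\triangleright k$ for some $k$, then there is $l$ with $a,b\triangleright l$ and $l,c\triangleright d$. A model adds a valuation $v$ from atoms to subsets of $\mathcal{M}$. Forcing: $m\Vdash p$ iff $m\in v(p)$; $m\Vdash\top^*$ iff $m=\epsilon$; $\top$ always, $\bot$ never; $\land,\lor,\to,\neg$ classical pointwise; $m\Vdash A*B$ iff there are $a,b$ with $a,b\triangleright m$, $a\Vdash A$, $b\Vdash B$; $m\Vdash A\mathrel{-\!*}B$ iff for all $a,b$, if $m,a\triangleright b$ and $a\Vdash A$ then $b\Vdash B$. Syntax of sequents. Labels are label variables (from an infinite set $LVar$) or the constant $\epsilon$. A labelled formula is $w:A$; a relational atom is $(x,y\triangleright z)$ for labels $x,y,z$.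 A sequent $\Gamma\vdash\Delta$ has $\Gamma$ a finite multiset of labelled formulae and relational atoms and $\Delta$ a finite multiset of labelled formulae; ";" is multiset union. $\Gamma[y/x]$ replaces every occurrence of label $x$ by $y$. A sequent is valid iff for every frame, valuation $v$ and map $\rho$ from labels to $\mathcal{M}$ with $\rho(\epsilon)=\epsilon$: if $\rho(w)\Vdash A$ for every $w:A\in\Gamma$ and $\rho(x),\rho(y)\triangleright\rho(z)$ for every $(x,y\triangleright z)\in\Gamma$, then $\rho(w)\Vdash A$ for some $w:A\in\Delta$. Rules of $LS_{BBI}$ ("from premises infer conclusion"; $P$ atomic): id: infer $\Gamma;w:P\vdash w:P;\Delta$. $\bot L$: infer $\Gamma;w:\bot\vdash\Delta$. $\top R$: infer $\Gamma\vdash w:\top;\Delta$. $\top^*R$: infer $\Gamma\vdash\epsilon:\top^*;\Delta$. cut: from $\Gamma\vdash x:A;\Delta$ and $\Gamma';x:A\vdash\Delta'$ infer $\Gamma;\Gamma'\vdash\Delta;\Delta'$. $\top^*L$: from $\Gamma[\epsilon/w]\vdash\Delta[\epsilon/w]$ infer $\Gamma;w:\top^*\vdash\Delta$ ($w\neq\epsilon$). $\land L$: from $\Gamma;w:A;w:B\vdash\Delta$ infer $\Gamma;w:A\land B\vdash\Delta$. $\land R$: from $\Gamma\vdash w:A;\Delta$ and $\Gamma\vdash w:B;\Delta$ infer $\Gamma\vdash w:A\land B;\Delta$. $\to L$: from $\Gamma\vdash w:A;\Delta$ and $\Gamma;w:B\vdash\Delta$ infer $\Gamma;w:A\to B\vdash\Delta$.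 $\to R$: from $\Gamma;w:A\vdash w:B;\Delta$ infer $\Gamma\vdash w:A\to B;\Delta$. $*L$: from $(x,y\triangleright z);\Gamma;x:A;y:B\vdash\Delta$ infer $\Gamma;z:A*B\vdash\Delta$ ($x,y$ not in the conclusion). $\mathrel{-\!*}R$: from $(x,y\triangleright z);\Gamma;x:A\vdash z:B;\Delta$ infer $\Gamma\vdash y:A\mathrel{-\!*}B;\Delta$ ($x,z$ not in the conclusion). $*R$: from $(x,y\triangleright z);\Gamma\vdash x:A;z:A*B;\Delta$ and $(x,y\triangleright z);\Gamma\vdash y:B;z:A*B;\Delta$ infer $(x,y\triangleright z);\Gamma\vdash z:A*B;\Delta$. $\mathrel{-\!*}L$: from $(x,y\triangleright z);\Gamma;y:A\mathrel{-\!*}B\vdash x:A;\Delta$ and $(x,y\triangleright z);\Gamma;y:A\mathrel{-\!*}B;z:B\vdash\Delta$ infer $(x,y\triangleright z);\Gamma;y:A\mathrel{-\!*}B\vdash\Delta$. E: from $(y,x\triangleright z);(x,y\triangleright z);\Gamma\vdash\Delta$ infer $(x,y\triangleright z);\Gamma\vdash\Delta$. U: from $(x,\epsilon\triangleright x);\Gamma\vdash\Delta$ infer $\Gamma\vdash\Delta$. A: from $(u,w\triangleright z);(y,v\triangleright w);(x,y\triangleright z);(u,v\triangleright x);\Gamma\vdash\Delta$ infer $(x,y\triangleright z);(u,v\triangleright x);\Gamma\vdash\Delta$ ($w$ not in the conclusion). $A_C$: from $(x,w\triangleright x);(y,y\triangleright w);(x,y\triangleright x);\Gamma\vdash\Delta$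 infer $(x,y\triangleright x);\Gamma\vdash\Delta$ ($w$ not in the conclusion). $Eq_1$: from $(\epsilon,w'\triangleright w');\Gamma[w'/w]\vdash\Delta[w'/w]$ infer $(\epsilon,w\triangleright w');\Gamma\vdash\Delta$ ($w\neq\epsilon$). $Eq_2$: from $(\epsilon,w'\triangleright w');\Gamma[w'/w]\vdash\Delta[w'/w]$ infer $(\epsilon,w'\triangleright w);\Gamma\vdash\Delta$ ($w\neq\epsilon$). *)

theory Defs
  imports "HOL-Library.Multiset" "HOL-Library.Infinite_Typeclass"
begin

section \<open>Formulae and Kripke semantics of BBI\<close>

datatype 'p fm =
    Atom 'p
  | Top
  | Bot
  | And "'p fm" "'p fm"
  | Imp "'p fm" "'p fm"
  | TopStar
  | Star "'p fm" "'p fm"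
  | Wand "'p fm" "'p fm"

abbreviation Neg :: "'p fm \<Rightarrow> 'p fm" where
  "Neg A \<equiv> Imp A Bot"

abbreviation Or :: "'p fm \<Rightarrow> 'p fm \<Rightarrow> 'p fm" where
  "Or A B \<equiv> Neg (And (Neg A) (Neg B))"

text \<open>A triple \<open>(a, b, c) \<in> R\<close> stands for \<open>a, b \<triangleright> c\<close>.\<close>

locale bbi_frame =
  fixes M :: "'m set" and R :: "('m \<times> 'm \<times> 'm) set" and e :: 'm
  assumes nonempty: "M \<noteq> {}"
    and unit_closed: "e \<in> M"
    and rel_closed: "R \<subseteq> M \<times> M \<times> M"
    and unit: "\<lbrakk>a \<in> M; b \<in> M\<rbrakk> \<Longrightarrow> (e, a, b) \<in> R \<longleftrightarrow> a = b"
    and comm: "\<lbrakk>a \<in> M; b \<in> M; c \<in> M\<rbrakk> \<Longrightarrow> (a, b, c) \<in> R \<longleftrightarrow> (b, a, c) \<in> R"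
    and assoc: "\<lbrakk>a \<in> M; b \<in> M; c \<in> M; d \<in> M; \<exists>k\<in>M. (a, k, d) \<in> R \<and> (b, c, k) \<in> R\<rbrakk>
      \<Longrightarrow> \<exists>l\<in>M. (a, b, l) \<in> R \<and> (l, c, d) \<in> R"

primrec forces ::
  "'m set \<Rightarrow> ('m \<times> 'm \<times> 'm) set \<Rightarrow> 'm \<Rightarrow> ('p \<Rightarrow> 'm set) \<Rightarrow> 'm \<Rightarrow> 'p fm \<Rightarrow> bool" where
  "forces M R e v m (Atom p) \<longleftrightarrow> m \<in> v p"
| "forces M R e v m Top \<longleftrightarrow> True"
| "forces M R e v m Bot \<longleftrightarrow> False"
| "forces M R e v m (And A B) \<longleftrightarrow> forces M R e v m A \<and> forces M R e v m B"
| "forces M R e v m (Imp A B) \<longleftrightarrow> (forces M R e v m A \<longrightarrow> forces M R e v m B)"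
| "forces M R e v m TopStar \<longleftrightarrow> m = e"
| "forces M R e v m (Star A B) \<longleftrightarrow>
     (\<exists>a\<in>M. \<exists>b\<in>M. (a, b, m) \<in> R \<and> forces M R e v a A \<and> forces M R e v b B)"
| "forces M R e v m (Wand A B) \<longleftrightarrow>
     (\<forall>a\<in>M. \<forall>b\<in>M. (m, a, b) \<in> R \<and> forces M R e v a A \<longrightarrow> forces M R e v b B)"

lemma forces_Neg: "forces M R e v m (Neg A) \<longleftrightarrow> \<not> forces M R e v m A"
  by simp

lemma forces_Or: "forces M R e v m (Or A B) \<longleftrightarrow> forces M R e v m A \<or> forces M R e v m B"
  by simp


section \<open>Labelled sequents\<close>

datatype 'v label = LVar 'v | Eps

text \<open>Antecedents mix labelled formulae \<open>Fm w A\<close> (that is, \<open>w : A\<close>) with relational atoms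
  \<open>Rel x y z\<close> (that is, \<open>x, y \<triangleright> z\<close>); succedents contain labelled formulae \<open>(w, A)\<close> only.\<close>

datatype ('p, 'v) item =
    Fm "'v label" "'p fm"
  | Rel "'v label" "'v label" "'v label"

type_synonym ('p, 'v) antecedent = "('p, 'v) item multiset"
type_synonym ('p, 'v) succedent = "('v label \<times> 'p fm) multiset"

datatype ('p, 'v) sequent =
  Sequent "('p, 'v) antecedent" "('p, 'v) succedent"  (infix "\<turnstile>" 40)

primrec item_labels :: "('p, 'v) item \<Rightarrow> 'v label set" where
  "item_labels (Fm w A) = {w}"
| "item_labels (Rel x y z) = {x, y, z}"

primrec seq_labels :: "('p, 'v) sequent \<Rightarrow> 'v label set" where
  "seq_labels (\<Gamma> \<turnstile> \<Delta>) = (\<Union>i\<in>set_mset \<Gamma>. item_labels i) \<union> fst ` set_mset \<Delta>"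

text \<open>Eigenvariables are label variables: \<open>Eps\<close> is never fresh, even if it does not occur.\<close>

definition fresh :: "'v label \<Rightarrow> ('p, 'v) sequent \<Rightarrow> bool" where
  "fresh x S \<longleftrightarrow> x \<noteq> Eps \<and> x \<notin> seq_labels S"

text \<open>In the substitution functions the new label \<open>y\<close> comes first, as in \<open>\<Gamma>[y/x]\<close>.\<close>

definition subst_label :: "'v label \<Rightarrow> 'v label \<Rightarrow> 'v label \<Rightarrow> 'v label" where
  "subst_label y x l = (if l = x then y else l)"

primrec subst_item :: "'v label \<Rightarrow> 'v label \<Rightarrow> ('p, 'v) item \<Rightarrow> ('p, 'v) item" where
  "subst_item y x (Fm w A) = Fm (subst_label y x w) A"
| "subst_item y x (Rel a b c) = Rel (subst_label y x a) (subst_label y x b) (subst_label y x c)"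

definition subst_ant ::
  "'v label \<Rightarrow> 'v label \<Rightarrow> ('p, 'v) antecedent \<Rightarrow> ('p, 'v) antecedent" where
  "subst_ant y x \<Gamma> = image_mset (subst_item y x) \<Gamma>"

definition subst_suc ::
  "'v label \<Rightarrow> 'v label \<Rightarrow> ('p, 'v) succedent \<Rightarrow> ('p, 'v) succedent" where
  "subst_suc y x \<Delta> = image_mset (\<lambda>(w, A). (subst_label y x w, A)) \<Delta>"

text \<open>Validity over all frames whose worlds are drawn from the type \<open>'m\<close>. A formula cannot
  quantify over types, so validity over all frames is validity for a schematic \<open>'m\<close>.\<close>

definition valid :: "'m itself \<Rightarrow> ('p, 'v) sequent \<Rightarrow> bool" where
  "valid T S \<longleftrightarrow> (case S of \<Gamma> \<turnstile> \<Delta> \<Rightarrow>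
     \<forall>(M :: 'm set) R e (v :: 'p \<Rightarrow> 'm set) (\<rho> :: 'v label \<Rightarrow> 'm).
       bbi_frame M R e \<longrightarrow> (\<forall>p. v p \<subseteq> M) \<longrightarrow> (\<forall>l. \<rho> l \<in> M) \<longrightarrow> \<rho> Eps = e \<longrightarrow>
       (\<forall>w A. Fm w A \<in># \<Gamma> \<longrightarrow> forces M R e v (\<rho> w) A) \<longrightarrow>
       (\<forall>x y z. Rel x y z \<in># \<Gamma> \<longrightarrow> (\<rho> x, \<rho> y, \<rho> z) \<in> R) \<longrightarrow>
       (\<exists>w A. (w, A) \<in># \<Delta> \<and> forces M R e v (\<rho> w) A))"


section \<open>The calculus\<close>

text \<open>Two eigenvariables of the same rule instance are distinct.\<close>

inductive LS_BBI :: "('p, 'v :: infinite) sequent \<Rightarrow> bool" where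
  id: "LS_BBI (add_mset (Fm w (Atom p)) \<Gamma> \<turnstile> add_mset (w, Atom p) \<Delta>)"
| cut: "\<lbrakk>LS_BBI (\<Gamma> \<turnstile> add_mset (x, A) \<Delta>); LS_BBI (add_mset (Fm x A) \<Gamma>' \<turnstile> \<Delta>')\<rbrakk>
    \<Longrightarrow> LS_BBI (\<Gamma> + \<Gamma>' \<turnstile> \<Delta> + \<Delta>')"
| BotL: "LS_BBI (add_mset (Fm w Bot) \<Gamma> \<turnstile> \<Delta>)"
| TopR: "LS_BBI (\<Gamma> \<turnstile> add_mset (w, Top) \<Delta>)"
| TopStarL: "\<lbrakk>LS_BBI (subst_ant Eps w \<Gamma> \<turnstile> subst_suc Eps w \<Delta>); w \<noteq> Eps\<rbrakk>
    \<Longrightarrow> LS_BBI (add_mset (Fm w TopStar) \<Gamma> \<turnstile> \<Delta>)"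
| TopStarR: "LS_BBI (\<Gamma> \<turnstile> add_mset (Eps, TopStar) \<Delta>)"
| AndL: "LS_BBI (add_mset (Fm w A) (add_mset (Fm w B) \<Gamma>) \<turnstile> \<Delta>)
    \<Longrightarrow> LS_BBI (add_mset (Fm w (And A B)) \<Gamma> \<turnstile> \<Delta>)"
| AndR: "\<lbrakk>LS_BBI (\<Gamma> \<turnstile> add_mset (w, A) \<Delta>); LS_BBI (\<Gamma> \<turnstile> add_mset (w, B) \<Delta>)\<rbrakk>
    \<Longrightarrow> LS_BBI (\<Gamma> \<turnstile> add_mset (w, And A B) \<Delta>)"
| ImpL: "\<lbrakk>LS_BBI (\<Gamma> \<turnstile> add_mset (w, A) \<Delta>); LS_BBI (add_mset (Fm w B) \<Gamma> \<turnstile> \<Delta>)\<rbrakk>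
    \<Longrightarrow> LS_BBI (add_mset (Fm w (Imp A B)) \<Gamma> \<turnstile> \<Delta>)"
| ImpR: "LS_BBI (add_mset (Fm w A) \<Gamma> \<turnstile> add_mset (w, B) \<Delta>)
    \<Longrightarrow> LS_BBI (\<Gamma> \<turnstile> add_mset (w, Imp A B) \<Delta>)"
| StarL: "\<lbrakk>LS_BBI (add_mset (Rel x y z) (add_mset (Fm x A) (add_mset (Fm y B) \<Gamma>)) \<turnstile> \<Delta>);
     fresh x (add_mset (Fm z (Star A B)) \<Gamma> \<turnstile> \<Delta>);
     fresh y (add_mset (Fm z (Star A B)) \<Gamma> \<turnstile> \<Delta>); x \<noteq> y\<rbrakk>
    \<Longrightarrow> LS_BBI (add_mset (Fm z (Star A B)) \<Gamma> \<turnstile> \<Delta>)"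
| StarR: "\<lbrakk>LS_BBI (add_mset (Rel x y z) \<Gamma> \<turnstile> add_mset (x, A) (add_mset (z, Star A B) \<Delta>));
     LS_BBI (add_mset (Rel x y z) \<Gamma> \<turnstile> add_mset (y, B) (add_mset (z, Star A B) \<Delta>))\<rbrakk>
    \<Longrightarrow> LS_BBI (add_mset (Rel x y z) \<Gamma> \<turnstile> add_mset (z, Star A B) \<Delta>)"
| WandL: "\<lbrakk>LS_BBI (add_mset (Rel x y z) (add_mset (Fm y (Wand A B)) \<Gamma>) \<turnstile> add_mset (x, A) \<Delta>);
     LS_BBI (add_mset (Rel x y z) (add_mset (Fm y (Wand A B)) (add_mset (Fm z B) \<Gamma>)) \<turnstile> \<Delta>)\<rbrakk>
    \<Longrightarrow> LS_BBI (add_mset (Rel x y z) (add_mset (Fm y (Wand A B)) \<Gamma>) \<turnstile> \<Delta>)"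
| WandR: "\<lbrakk>LS_BBI (add_mset (Rel x y z) (add_mset (Fm x A) \<Gamma>) \<turnstile> add_mset (z, B) \<Delta>);
     fresh x (\<Gamma> \<turnstile> add_mset (y, Wand A B) \<Delta>);
     fresh z (\<Gamma> \<turnstile> add_mset (y, Wand A B) \<Delta>); x \<noteq> z\<rbrakk>
    \<Longrightarrow> LS_BBI (\<Gamma> \<turnstile> add_mset (y, Wand A B) \<Delta>)"
| E: "LS_BBI (add_mset (Rel y x z) (add_mset (Rel x y z) \<Gamma>) \<turnstile> \<Delta>)
    \<Longrightarrow> LS_BBI (add_mset (Rel x y z) \<Gamma> \<turnstile> \<Delta>)"
| U: "LS_BBI (add_mset (Rel x Eps x) \<Gamma> \<turnstile> \<Delta>) \<Longrightarrow> LS_BBI (\<Gamma> \<turnstile> \<Delta>)"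
| A: "\<lbrakk>LS_BBI (add_mset (Rel u w z) (add_mset (Rel y v w)
        (add_mset (Rel x y z) (add_mset (Rel u v x) \<Gamma>))) \<turnstile> \<Delta>);
     fresh w (add_mset (Rel x y z) (add_mset (Rel u v x) \<Gamma>) \<turnstile> \<Delta>)\<rbrakk>
    \<Longrightarrow> LS_BBI (add_mset (Rel x y z) (add_mset (Rel u v x) \<Gamma>) \<turnstile> \<Delta>)"
| AC: "\<lbrakk>LS_BBI (add_mset (Rel x w x) (add_mset (Rel y y w) (add_mset (Rel x y x) \<Gamma>)) \<turnstile> \<Delta>);
     fresh w (add_mset (Rel x y x) \<Gamma> \<turnstile> \<Delta>)\<rbrakk>
    \<Longrightarrow> LS_BBI (add_mset (Rel x y x) \<Gamma> \<turnstile> \<Delta>)"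
| Eq1: "\<lbrakk>LS_BBI (add_mset (Rel Eps w' w') (subst_ant w' w \<Gamma>) \<turnstile> subst_suc w' w \<Delta>); w \<noteq> Eps\<rbrakk>
    \<Longrightarrow> LS_BBI (add_mset (Rel Eps w w') \<Gamma> \<turnstile> \<Delta>)"
| Eq2: "\<lbrakk>LS_BBI (add_mset (Rel Eps w' w') (subst_ant w' w \<Gamma>) \<turnstile> subst_suc w' w \<Delta>); w \<noteq> Eps\<rbrakk>
    \<Longrightarrow> LS_BBI (add_mset (Rel Eps w' w) \<Gamma> \<turnstile> \<Delta>)"

end

theory Submission
  imports Defs
begin

text \<open>Soundness is proved by induction on the derivation, with a frame and a valuation fixed:
  each rule carries truth of its premises under all assignments of worlds to labels over to truth of
  its conclusion under a given assignment \<rho>. The rules fall into three groups. The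
  propositional rules, \<open>cut\<close>, \<open>StarR\<close>, \<open>WandL\<close>,
  \<open>E\<close> and \<open>U\<close> use the premises at \<rho> itself, together with the forcing
  clauses or a frame property. The rules with eigenvariables (\<open>StarL\<close>,
  \<open>WandR\<close>, \<open>A\<close>, \<open>AC\<close>) use the premise at a modified
  assignment: a forcing clause or associativity supplies witness worlds, the fresh labels are sent
  to them, and the conclusion does not notice the change (\<open>seq_holds_upd\<close>). The
  substituting rules (\<open>TopStarL\<close>, \<open>Eq1\<close>, \<open>Eq2\<close>) rest on the
  fact that identifying two labels with the same value changes no truth value
  (\<open>seq_holds_subst\<close>); if the values differ, the antecedent of the conclusion is
  false.\<close>

context bbi_frame
begin

definition assignment :: "('v label \<Rightarrow> 'm) \<Rightarrow> bool" where
  "assignment \<rho> \<longleftrightarrow> range \<rho> \<subseteq> M \<and> \<rho> Eps = e"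

fun item_holds :: "('p \<Rightarrow> 'm set) \<Rightarrow> ('v label \<Rightarrow> 'm) \<Rightarrow> ('p, 'v) item \<Rightarrow> bool" where
  "item_holds v \<rho> (Fm w A) \<longleftrightarrow> forces M R e v (\<rho> w) A"
| "item_holds v \<rho> (Rel x y z) \<longleftrightarrow> (\<rho> x, \<rho> y, \<rho> z) \<in> R"

text \<open>Truth under a single assignment; validity quantifies over all of them. This pointwise
  notion is what the induction needs, since it compares premise and conclusion at different
  assignments.\<close>

fun seq_holds :: "('p \<Rightarrow> 'm set) \<Rightarrow> ('v label \<Rightarrow> 'm) \<Rightarrow> ('p, 'v) sequent \<Rightarrow> bool" where
  "seq_holds v \<rho> (\<Gamma> \<turnstile> \<Delta>) \<longleftrightarrow>
     ((\<forall>i\<in>#\<Gamma>. item_holds v \<rho> i) \<longrightarrow> (\<exists>(w, A)\<in>#\<Delta>. forces M R e v (\<rho> w) A))"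

lemma assignment_in: "assignment \<rho> \<Longrightarrow> \<rho> l \<in> M"
  by (auto simp: assignment_def)

lemma assignment_Eps: "assignment \<rho> \<Longrightarrow> \<rho> Eps = e"
  by (simp add: assignment_def)

lemma assignment_upd: "\<lbrakk>assignment \<rho>; x \<noteq> Eps; a \<in> M\<rbrakk> \<Longrightarrow> assignment (\<rho>(x := a))"
  by (auto simp: assignment_def)

lemma item_holds_upd: "x \<notin> item_labels i \<Longrightarrow> item_holds v (\<rho>(x := a)) i = item_holds v \<rho> i"
  by (cases i) auto

text \<open>Truth depends only on the values of labels that occur. This is how the eigenvariable
  cases return from the modified assignment to the original one.\<close>

lemma seq_holds_upd:
  assumes "x \<notin> seq_labels S"
  shows "seq_holds v (\<rho>(x := a)) S = seq_holds v \<rho> S"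
proof (cases S)
  case (Sequent \<Gamma> \<Delta>)
  with assms have "\<And>i. i \<in># \<Gamma> \<Longrightarrow> item_holds v (\<rho>(x := a)) i = item_holds v \<rho> i"
    by (intro item_holds_upd) auto
  moreover from Sequent assms have "\<And>w A. (w, A) \<in># \<Delta> \<Longrightarrow> w \<noteq> x"
    by force
  ultimately show ?thesis
    unfolding Sequent by (fastforce split: prod.splits)
qed

lemma item_holds_subst:
  assumes "\<rho> y = \<rho> x"
  shows "item_holds v \<rho> (subst_item y x i) = item_holds v \<rho> i"
  using assms by (cases i) (auto simp: subst_label_def)

lemma seq_holds_subst:
  assumes "\<rho> y = \<rho> x"
  shows "seq_holds v \<rho> (subst_ant y x \<Gamma> \<turnstile> subst_suc y x \<Delta>) = seq_holds v \<rho> (\<Gamma> \<turnstile> \<Delta>)"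
proof -
  have "\<rho> (subst_label y x l) = \<rho> l" for l
    using assms by (simp add: subst_label_def)
  then show ?thesis
    by (simp add: subst_ant_def subst_suc_def item_holds_subst[of \<rho>, OF assms] case_prod_unfold)
qed

text \<open>In the premises of \<open>Eq1\<close> and \<open>Eq2\<close> the leading atom stands
  outside the substitution, so \<open>seq_holds_subst\<close> does not match them directly.\<close>

lemma seq_holds_subst_Rel:
  assumes "\<rho> y = \<rho> x"
  shows "seq_holds v \<rho> (add_mset (Rel a b c) (subst_ant y x \<Gamma>) \<turnstile> subst_suc y x \<Delta>)
    \<longleftrightarrow> seq_holds v \<rho> (add_mset (Rel a b c) \<Gamma> \<turnstile> \<Delta>)"
  using seq_holds_subst[of \<rho>, OF assms, where v = v and \<Gamma> = \<Gamma> and \<Delta> = \<Delta>] by auto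

lemma R_comm: "(a, b, c) \<in> R \<longleftrightarrow> (b, a, c) \<in> R"
  using comm rel_closed by blast

text \<open>The frame axiom reassociates in one direction only, and the rule \<open>A\<close> needs
  the opposite one. Commuting both given triples brings them into the form of the axiom; commuting
  one resulting triple back gives the claim.\<close>

lemma R_assoc:
  assumes "(x, y, z) \<in> R" "(u, t, x) \<in> R"
  obtains w where "w \<in> M" "(u, w, z) \<in> R" "(y, t, w) \<in> R"
proof -
  have "(y, x, z) \<in> R" "(t, u, x) \<in> R"
    using assms R_comm by blast+
  moreover have "x \<in> M" "y \<in> M" "z \<in> M" "u \<in> M" "t \<in> M"
    using assms rel_closed by auto
  ultimately obtain w where "w \<in> M" "(y, t, w) \<in> R" "(w, u, z) \<in> R"
    using assoc[of y t u z] by blast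
  with that show thesis using R_comm by blast
qed

lemma R_unit: "(e, a, b) \<in> R \<Longrightarrow> a = b"
  using unit rel_closed by blast

theorem LS_BBI_sound:
  assumes "LS_BBI S" "assignment \<rho>"
  shows "seq_holds v \<rho> S"
  using assms
\<comment> \<open>The assignment must stay general: the eigenvariable cases apply the induction
  hypothesis at an assignment other than \<rho>.\<close>
proof (induction S arbitrary: \<rho> rule: LS_BBI.induct)
  case (TopStarL w \<Gamma> \<Delta>)
  show ?case
  \<comment> \<open>Either \<open>w\<close> and \<open>Eps\<close> have the same value, so the
    substitution is harmless, or \<open>w : TopStar\<close> is false and so is the
    antecedent.\<close>
  proof (cases "\<rho> w = e")
    case True
    with TopStarL show ?thesis
      using seq_holds_subst[of \<rho> Eps w v \<Gamma> \<Delta>] by (auto simp: assignment_Eps)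
  qed auto
next
  case (StarL x y z A B \<Gamma> \<Delta>)
  let ?S = "add_mset (Fm z (Star A B)) \<Gamma> \<turnstile> \<Delta>"
  show ?case
  proof (cases "forces M R e v (\<rho> z) (Star A B)")
    case True
    then obtain a b where ab: "a \<in> M" "b \<in> M" "(a, b, \<rho> z) \<in> R"
      "forces M R e v a A" "forces M R e v b B"
      by auto
    \<comment> \<open>The eigenvariables name the two parts into which the world of \<open>z\<close>
      splits. Freshness excludes \<open>Eps\<close>, so \<sigma> still sends \<open>Eps\<close> to
      the unit, and it keeps the value of \<open>z\<close>.\<close>
    define \<sigma> where "\<sigma> = \<rho>(x := a, y := b)"
    have "assignment \<sigma>"
      using StarL ab unfolding \<sigma>_def by (auto intro!: assignment_upd simp: fresh_def)
    moreover have "\<sigma> x = a" "\<sigma> y = b" "\<sigma> z = \<rho> z"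
      using StarL.hyps by (auto simp: \<sigma>_def fresh_def)
    ultimately have "seq_holds v \<sigma> ?S"
      using StarL.IH[of \<sigma>] ab by auto
    with StarL.hyps show ?thesis
      by (simp add: \<sigma>_def fresh_def seq_holds_upd del: seq_holds.simps)
  qed auto
next
  case (StarR x y z \<Gamma> A \<Delta> B)
  from StarR.IH[OF StarR.prems] show ?case
    using assignment_in[OF StarR.prems] by auto
next
  case (WandL x y z A B \<Gamma> \<Delta>)
  \<comment> \<open>The rule has the wand's world in second place of the atom, the forcing clause in
    first place; commutativity reconciles them.\<close>
  have "forces M R e v (\<rho> z) B"
    if "(\<rho> x, \<rho> y, \<rho> z) \<in> R" "forces M R e v (\<rho> y) (Wand A B)" "forces M R e v (\<rho> x) A"
    using that R_comm[of "\<rho> x"] assignment_in[OF WandL.prems] unfolding forces.simps by blast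
  with WandL.IH[OF WandL.prems] show ?case
    by (auto simp del: forces.simps)
next
  case (WandR x y z A \<Gamma> B \<Delta>)
  let ?S = "\<Gamma> \<turnstile> add_mset (y, Wand A B) \<Delta>"
  show ?case
  proof (cases "forces M R e v (\<rho> y) (Wand A B)")
    case False
    \<comment> \<open>A counterexample to the wand at the world of \<open>y\<close>: under \<sigma>
      it makes the added atom and \<open>x : A\<close> true and \<open>z : B\<close> false, so the
      premise must be satisfied through the context.\<close>
    then obtain a b where ab: "a \<in> M" "b \<in> M" "(a, \<rho> y, b) \<in> R"
      "forces M R e v a A" "\<not> forces M R e v b B"
      using R_comm[of "\<rho> y"] unfolding forces.simps by blast
    define \<sigma> where "\<sigma> = \<rho>(x := a, z := b)"
    have "assignment \<sigma>"
      using WandR ab unfolding \<sigma>_def by (auto intro!: assignment_upd simp: fresh_def)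
    moreover have "\<sigma> x = a" "\<sigma> z = b" "\<sigma> y = \<rho> y"
      using WandR.hyps by (auto simp: \<sigma>_def fresh_def)
    ultimately have "seq_holds v \<sigma> ?S"
      using WandR.IH[of \<sigma>] ab by auto
    with WandR.hyps show ?thesis
      by (simp add: \<sigma>_def fresh_def seq_holds_upd del: seq_holds.simps)
  qed auto
next
  case (E y x z \<Gamma> \<Delta>)
  then show ?case using R_comm[of "\<rho> x" "\<rho> y" "\<rho> z"] by auto
next
  case (U x \<Gamma> \<Delta>)
  \<comment> \<open>The unit axiom has the unit on the left, the rule has it on the right.\<close>
  have "(\<rho> x, \<rho> Eps, \<rho> x) \<in> R"
    using unit[of "\<rho> x" "\<rho> x"] R_comm[of e "\<rho> x" "\<rho> x"]
    by (simp add: assignment_in[OF U.prems] assignment_Eps[OF U.prems])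
  with U.IH[OF U.prems] show ?case by simp
next
  \<comment> \<open>The label written \<open>v\<close> in the rule is called \<open>t\<close> here,
    since \<open>v\<close> is the valuation.\<close>
  case (A u w z y t x \<Gamma> \<Delta>)
  let ?S = "add_mset (Rel x y z) (add_mset (Rel u t x) \<Gamma>) \<turnstile> \<Delta>"
  show ?case
  proof (cases "(\<rho> x, \<rho> y, \<rho> z) \<in> R \<and> (\<rho> u, \<rho> t, \<rho> x) \<in> R")
    case True
    then obtain a where a: "a \<in> M" "(\<rho> u, a, \<rho> z) \<in> R" "(\<rho> y, \<rho> t, a) \<in> R"
      using R_assoc by blast
    define \<sigma> where "\<sigma> = \<rho>(w := a)"
    have "assignment \<sigma>"
      using A a unfolding \<sigma>_def by (auto intro!: assignment_upd simp: fresh_def)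
    moreover have "\<sigma> w = a" "\<sigma> x = \<rho> x" "\<sigma> y = \<rho> y" "\<sigma> z = \<rho> z" "\<sigma> u = \<rho> u" "\<sigma> t = \<rho> t"
      using A.hyps by (auto simp: \<sigma>_def fresh_def)
    ultimately have "seq_holds v \<sigma> ?S"
      using A.IH[of \<sigma>] a by auto
    with A.hyps show ?thesis
      by (simp add: \<sigma>_def fresh_def seq_holds_upd del: seq_holds.simps)
  qed auto
next
  case (AC x w y \<Gamma> \<Delta>)
  let ?S = "add_mset (Rel x y x) \<Gamma> \<turnstile> \<Delta>"
  show ?case
  proof (cases "(\<rho> x, \<rho> y, \<rho> x) \<in> R")
    case True
    \<comment> \<open>Associativity with the single triple of this case taken for both of its
      hypotheses; this is why \<open>AC\<close> needs only one atom.\<close>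
    then obtain a where a: "a \<in> M" "(\<rho> x, a, \<rho> x) \<in> R" "(\<rho> y, \<rho> y, a) \<in> R"
      using R_assoc by blast
    define \<sigma> where "\<sigma> = \<rho>(w := a)"
    have "assignment \<sigma>"
      using AC a unfolding \<sigma>_def by (auto intro!: assignment_upd simp: fresh_def)
    moreover have "\<sigma> w = a" "\<sigma> x = \<rho> x" "\<sigma> y = \<rho> y"
      using AC.hyps by (auto simp: \<sigma>_def fresh_def)
    ultimately have "seq_holds v \<sigma> ?S"
      using AC.IH[of \<sigma>] a by auto
    with AC.hyps show ?thesis
      by (simp add: \<sigma>_def fresh_def seq_holds_upd del: seq_holds.simps)
  qed auto
next
  case (Eq1 w' w \<Gamma> \<Delta>)
  show ?case
  \<comment> \<open>The unit axiom makes the atom \<open>Rel Eps w w'\<close> true only if its last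
    two labels have the same value. Then the atom \<open>Rel Eps w' w'\<close> of the premise has
    the same truth value as the one of the conclusion.\<close>
  proof (cases "\<rho> w' = \<rho> w")
    case True
    with Eq1.IH[OF Eq1.prems] show ?thesis
      by (auto simp: seq_holds_subst_Rel[of \<rho>, OF True] simp del: seq_holds.simps
        simp: seq_holds.simps[of v \<rho> "add_mset _ \<Gamma>" \<Delta>])
  next
    case False
    then show ?thesis using R_unit[of "\<rho> w" "\<rho> w'"] by (auto simp: assignment_Eps[OF Eq1.prems])
  qed
next
  case (Eq2 w' w \<Gamma> \<Delta>)
  show ?case
  proof (cases "\<rho> w' = \<rho> w")
    case True
    with Eq2.IH[OF Eq2.prems] show ?thesis
      by (auto simp: seq_holds_subst_Rel[of \<rho>, OF True] simp del: seq_holds.simps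
        simp: seq_holds.simps[of v \<rho> "add_mset _ \<Gamma>" \<Delta>])
  next
    case False
    then show ?thesis using R_unit[of "\<rho> w'" "\<rho> w"] by (auto simp: assignment_Eps[OF Eq2.prems])
  qed
next
  case (cut \<Gamma> x A \<Delta> \<Gamma>' \<Delta>')
  \<comment> \<open>If \<open>A\<close> is false at the world of \<open>x\<close>, the first premise
    yields a true formula in \<Delta>; if it is true, the second yields one in \<Delta>'.\<close>
  from cut.IH[OF cut.prems] show ?case by auto
next
  case (AndL w A B \<Gamma> \<Delta>)
  from AndL.IH[OF AndL.prems] show ?case by simp
next
  case (AndR \<Gamma> w A \<Delta> B)
  from AndR.IH[OF AndR.prems] show ?case by auto
next
  case (ImpL \<Gamma> w A \<Delta> B)
  from ImpL.IH[OF ImpL.prems] show ?case by auto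
next
  case (ImpR w A \<Gamma> B \<Delta>)
  from ImpR.IH[OF ImpR.prems] show ?case by auto
\<comment> \<open>The rules without premises remain; \<open>TopStarR\<close> holds because the value
  of \<open>Eps\<close> is the unit.\<close>
qed (simp_all add: assignment_Eps)

end

theorem theorem1:
  fixes \<Gamma> :: "('p, 'v :: infinite) antecedent" and \<Delta> :: "('p, 'v) succedent"
  assumes "LS_BBI (\<Gamma> \<turnstile> \<Delta>)"
  shows "valid TYPE('m) (\<Gamma> \<turnstile> \<Delta>)"
  unfolding valid_def sequent.case
proof (intro allI impI)
  fix M :: "'m set" and R e and v :: "'p \<Rightarrow> 'm set" and \<rho> :: "'v label \<Rightarrow> 'm"
  assume "bbi_frame M R e" and "\<forall>l. \<rho> l \<in> M" "\<rho> Eps = e"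
    and Fm: "\<forall>w A. Fm w A \<in># \<Gamma> \<longrightarrow> forces M R e v (\<rho> w) A"
    and Rel: "\<forall>x y z. Rel x y z \<in># \<Gamma> \<longrightarrow> (\<rho> x, \<rho> y, \<rho> z) \<in> R"
  then interpret bbi_frame M R e by simp
  have "assignment \<rho>"
    using \<open>\<forall>l. \<rho> l \<in> M\<close> \<open>\<rho> Eps = e\<close> by (auto simp: assignment_def)
  with assms have "seq_holds v \<rho> (\<Gamma> \<turnstile> \<Delta>)" by (rule LS_BBI_sound)
  \<comment> \<open>The two assumptions on the antecedent in \<open>valid\<close> are exactly the
    two cases of \<open>item_holds\<close>.\<close>
  moreover have "item_holds v \<rho> i" if "i \<in># \<Gamma>" for i
    using that Fm Rel by (cases i) auto
  ultimately show "\<exists>w A. (w, A) \<in># \<Delta> \<and> forces M R e v (\<rho> w) A"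
    by auto
qed

end
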